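(* Let $$f(t)=\frac{t\sin(t)-\cos(t)+e}{(1+t^{2})(e-1)},\qquad t\in\mathbb{R}.$$ Let $n\ge 0$ be an integer and let $a_0,a_1,\ldots,a_n>0$ and $b>0$ be real numbers with $a_0+a_1+\cdots+a_n<b$. Then $$\int_{-\infty}^{\infty}f(a_0t)f(a_1t)\cdots f(a_nt)\,\frac{\sin(bt)}{t}\,dt=\pi.$$
   Context: Here $e$ is the base of the natural logarithm, and the integrand at $t=0$ is given by its limiting value. *)

theory Defs
  imports "HOL-Analysis.Analysis"
begin

definition f :: "real \<Rightarrow> real" where
  "f t = (t * sin t - cos t + exp 1) / ((1 + t\<^sup>2) * (exp 1 - 1))"

definition integrand :: "nat \<Rightarrow> (nat \<Rightarrow> real) \<Rightarrow> real \<Rightarrow> real \<Rightarrow> real" where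
  "integrand n a b t =
     (if t = 0 then b else (\<Prod>i=0..n. f (a i * t)) * (sin (b * t) / t))"

text \<open>The value at \<open>t = 0\<close> is indeed the limiting value.\<close>

lemma integrand_tendsto_at_0: "(integrand n a b \<longlongrightarrow> integrand n a b 0) (at 0)"
proof -
  have cont: "isCont f x" for x
  proof -
    have "1 + x\<^sup>2 \<noteq> 0"
      by (metis add_pos_nonneg less_irrefl zero_le_power2 zero_less_one)
    moreover have "exp 1 - 1 \<noteq> (0::real)"
      by simp
    ultimately show ?thesis
      unfolding f_def by (intro continuous_intros) auto
  qed
  have f0: "f 0 = 1"
    by (simp add: f_def)
  have "((\<lambda>t. f (a i * t)) \<longlongrightarrow> f (a i * 0)) (at 0)" for i
    by (rule isCont_tendsto_compose[OF cont]) (intro tendsto_intros)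
  then have "((\<lambda>t. \<Prod>i=0..n. f (a i * t)) \<longlongrightarrow> (\<Prod>i=0..n. f (a i * 0))) (at 0)"
    by (intro tendsto_prod)
  then have P: "((\<lambda>t. \<Prod>i=0..n. f (a i * t)) \<longlongrightarrow> 1) (at 0)"
    by (simp add: f0)
  have "((\<lambda>t. sin (b * t)) has_real_derivative b) (at 0)"
    by (auto intro!: derivative_eq_intros)
  then have S: "((\<lambda>t. sin (b * t) / t) \<longlongrightarrow> b) (at 0)"
    by (simp add: has_field_derivative_iff)
  have "((\<lambda>t. (\<Prod>i=0..n. f (a i * t)) * (sin (b * t) / t)) \<longlongrightarrow> b) (at 0)"
    using tendsto_mult[OF P S] by simp
  moreover have "\<forall>\<^sub>F t in at 0.
      (\<Prod>i=0..n. f (a i * t)) * (sin (b * t) / t) = integrand n a b t"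
    by (auto simp: eventually_at_filter integrand_def)
  ultimately show ?thesis
    by (simp add: Lim_transform_eventually integrand_def [of n a b 0])
qed

end

theory Submission
  imports Defs "HOL-Probability.Levy"
begin

text \<open>
  The function \<open>f\<close> is the characteristic function of a probability measure carried by \<open>[-1, 1]\<close>:
  an elementary integration gives \<open>f t = e / (e - 1) * (\<integral>x=0..1. exp (-x) * cos (t * x))\<close>, and the
  right-hand side is the Fourier transform of the even density proportional to \<open>exp (-\<bar>x\<bar>)\<close>
  on \<open>[-1, 1]\<close> (\<open>char_truncated_laplace\<close>).

  Let \<open>X\<^sub>0, ..., X\<^sub>n\<close> be independent with this law. Then \<open>\<Prod>i. f (a\<^sub>i * t)\<close> is the characteristic
  function of \<open>S = \<Sum>i. a\<^sub>i * X\<^sub>i\<close>, and \<open>\<bar>S\<bar> \<le> \<Sum>i. a\<^sub>i < b\<close> almost surely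
  (\<open>weighted_sum_distribution\<close>). Because \<open>(exp (\<i>tb) - exp (-\<i>tb)) / (\<i>t) = 2 * sin (b * t) / t\<close>,
  Levy's inversion formula at the endpoints \<open>-b\<close> and \<open>b\<close> says that the integrals of the integrand
  over \<open>[-T, T]\<close> converge to \<open>\<pi> * P (-b < S \<le> b) = \<pi>\<close> (\<open>integral_char_sin_over_t\<close>). Thus the
  value is \<open>\<pi>\<close> as long as \<open>S\<close> cannot leave \<open>(-b, b)\<close>, whatever its law is.

  Inversion only gives a principal value. A single factor \<open>f (a\<^sub>0 * t) = O(1 / t)\<close> together with
  \<open>1 / t\<close> makes the integrand absolutely integrable (\<open>integrable_integrand\<close>), so that the
  principal value is the Lebesgue integral.
\<close>

section \<open>A probability measure with characteristic function \<open>f\<close>\<close>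

definition truncated_laplace_density :: "real \<Rightarrow> real" where
  "truncated_laplace_density x = indicator {-1..1} x * (exp 1 / (2 * (exp 1 - 1)) * exp (-\<bar>x\<bar>))"

definition truncated_laplace :: "real measure" where
  "truncated_laplace = density lborel truncated_laplace_density"

lemma borel_measurable_truncated_laplace_density [measurable]:
  "truncated_laplace_density \<in> borel_measurable borel"
  unfolding truncated_laplace_density_def by measurable

text \<open>
  On each half of \<open>[-1, 1]\<close> the integrand is a single exponential, \<open>exp (p * x)\<close> on the left and
  \<open>exp (q * x)\<close> on the right with \<open>p = 1 + \<i>t\<close> and \<open>q = \<i>t - 1\<close>. The two primitives combine over
  \<open>p * q = - (1 + t\<^sup>2)\<close>, the denominator of \<open>f\<close>.
\<close>
lemma has_bochner_integral_truncated_laplace_iexp: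
  "has_bochner_integral lborel
     (\<lambda>x. truncated_laplace_density x *\<^sub>R iexp (t * x))
     (complex_of_real (f t))"
proof -
  define c :: real where "c = exp 1 / (2 * (exp 1 - 1))"
  define p q where "p = 1 + \<i> * complex_of_real t" and "q = \<i> * complex_of_real t - 1"
  have p0: "p \<noteq> 0" and q0: "q \<noteq> 0"
    by (auto simp: p_def q_def complex_eq_iff)
  have left: "has_bochner_integral lborel
      (\<lambda>x. indicator {-1..0} x *\<^sub>R exp (p * complex_of_real x))
      (exp (p * of_real 0) / p - exp (p * of_real (-1)) / p)"
    using p0 by (intro has_bochner_integral_FTC_Icc)
      (auto intro!: continuous_intros derivative_eq_intros has_vector_derivative_real_field)
  have right: "has_bochner_integral lborel
      (\<lambda>x. indicator {0..1} x *\<^sub>R exp (q * complex_of_real x))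
      (exp (q * of_real 1) / q - exp (q * of_real 0) / q)"
    using q0 by (intro has_bochner_integral_FTC_Icc)
      (auto intro!: continuous_intros derivative_eq_intros has_vector_derivative_real_field)
  let ?I = "(exp (p * of_real 0) / p - exp (p * of_real (-1)) / p) +
     (exp (q * of_real 1) / q - exp (q * of_real 0) / q)"
  \<comment> \<open>The two closed halves overlap in \<open>0\<close>, so the decomposition fails at that point.\<close>
  have ae: "AE x in lborel.
      c *\<^sub>R (indicator {-1..0} x *\<^sub>R exp (p * complex_of_real x) +
            indicator {0..1} x *\<^sub>R exp (q * complex_of_real x)) =
      (indicator {-1..1} x * (c * exp (-\<bar>x\<bar>))) *\<^sub>R iexp (t * x)"
    using AE_lborel_singleton[of "0::real"]
  proof eventually_elim
    case (elim x)
    show ?case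
    proof (cases "x < 0")
      case True
      then have "exp (p * complex_of_real x) = exp (-\<bar>x\<bar>) *\<^sub>R iexp (t * x)"
        by (simp add: p_def algebra_simps exp_add scaleR_conv_of_real flip: exp_of_real)
      with True show ?thesis by (auto split: split_indicator)
    next
      case False
      then have "exp (q * complex_of_real x) = exp (-\<bar>x\<bar>) *\<^sub>R iexp (t * x)"
        by (simp add: q_def algebra_simps exp_diff exp_minus field_simps scaleR_conv_of_real
            flip: exp_of_real)
      with False elim show ?thesis by (auto split: split_indicator)
    qed
  qed
  have val: "c *\<^sub>R ?I = complex_of_real (f t)"
  proof -
    define E :: real where "E = exp 1"
    have E: "E > 0" "E \<noteq> 1" by (auto simp: E_def)
    have ep: "exp (- p) = of_real (1 / E) * cis (- t)"
      by (simp add: p_def E_def exp_diff exp_minus cis_conv_exp field_simps flip: exp_of_real)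
    have eq: "exp q = of_real (1 / E) * cis t"
      by (simp add: q_def E_def exp_diff cis_conv_exp flip: exp_of_real)
    have pq: "p * q = - of_real (1 + t\<^sup>2)"
      by (simp add: p_def q_def algebra_simps power2_eq_square)
    have t0: "1 + t\<^sup>2 \<noteq> 0" by (metis add_pos_nonneg less_irrefl zero_le_power2 zero_less_one)
    have "?I = (q * (1 - exp (- p)) + p * (exp q - 1)) / (p * q)"
      using p0 q0 by (simp add: divide_simps)
    also have "q * (1 - exp (- p)) + p * (exp q - 1) =
        of_real (- (2 + 2 * (t * sin t - cos t) / E))"
      using E unfolding ep eq
      by (simp add: p_def q_def complex_eq_iff field_simps)
    also have "\<dots> / (p * q) = of_real ((2 + 2 * (t * sin t - cos t) / E) / (1 + t\<^sup>2))"
      unfolding pq by (simp only: of_real_minus minus_divide_divide of_real_divide)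
    finally have I: "?I = of_real ((2 + 2 * (t * sin t - cos t) / E) / (1 + t\<^sup>2))" .
    have "c * ((2 + 2 * (t * sin t - cos t) / E) / (1 + t\<^sup>2)) = f t"
      using E t0 unfolding c_def f_def E_def[symmetric]
      by (simp add: divide_simps) (simp add: algebra_simps)
    then show ?thesis unfolding I scaleR_conv_of_real of_real_mult[symmetric] by (rule arg_cong)
  qed
  have "has_bochner_integral lborel
     (\<lambda>x. c *\<^sub>R (indicator {-1..0} x *\<^sub>R exp (p * complex_of_real x) +
            indicator {0..1} x *\<^sub>R exp (q * complex_of_real x))) (c *\<^sub>R ?I)"
    by (intro has_bochner_integral_scaleR_right has_bochner_integral_add left right)
  then show ?thesis
    unfolding val truncated_laplace_density_def c_def[symmetric]
    by (subst has_bochner_integral_cong_AE[symmetric, OF _ _ ae]) auto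
qed

lemma truncated_laplace_density_nonneg: "0 \<le> truncated_laplace_density x"
  by (auto simp: truncated_laplace_density_def indicator_def)

lemma char_truncated_laplace: "char truncated_laplace t = f t"
proof -
  have "char truncated_laplace t =
      (CLINT x|lborel. truncated_laplace_density x *\<^sub>R
        iexp (t * x))"
    unfolding char_def truncated_laplace_def
    by (rule integral_density) (auto simp: truncated_laplace_density_nonneg)
  also have "\<dots> = f t"
    by (rule has_bochner_integral_integral_eq[OF has_bochner_integral_truncated_laplace_iexp])
  finally show ?thesis .
qed

text \<open>The total mass is the Fourier integral at \<open>t = 0\<close>, and \<open>f 0 = 1\<close>.\<close>
lemma real_distribution_truncated_laplace: "real_distribution truncated_laplace"
proof -
  let ?w = truncated_laplace_density
  have "has_bochner_integral lborel (\<lambda>x. complex_of_real (?w x)) (complex_of_real 1)"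
    using has_bochner_integral_truncated_laplace_iexp[of 0]
    by (simp add: f_def scaleR_conv_of_real)
  then have "has_bochner_integral lborel (\<lambda>x. Re (complex_of_real (?w x))) (Re (complex_of_real 1))"
    by (rule has_bochner_integral_Re)
  then have "has_bochner_integral lborel ?w 1" by simp
  then have "(\<integral>\<^sup>+x. ennreal (?w x) \<partial>lborel) = 1"
    using nn_integral_eq_integral[of lborel ?w, OF _ AE_I2[OF truncated_laplace_density_nonneg]]
    unfolding has_bochner_integral_iff by (simp only: ennreal_1)
  then have "prob_space truncated_laplace"
    by (intro prob_spaceI) (simp add: truncated_laplace_def emeasure_density)
  then show ?thesis
    by (auto simp: real_distribution_def real_distribution_axioms_def truncated_laplace_def)
qed

lemma AE_truncated_laplace_bounded: "AE x in truncated_laplace. \<bar>x\<bar> \<le> 1"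
  unfolding truncated_laplace_def
  by (subst AE_density) (auto simp: truncated_laplace_density_def indicator_def)

lemma abs_f_le_1: "\<bar>f t\<bar> \<le> 1"
  using real_distribution.cmod_char_le_1[OF real_distribution_truncated_laplace, of t]
  by (simp add: char_truncated_laplace)

section \<open>Products of characteristic functions\<close>

lemma char_distr_scale:
  assumes "real_distribution M"
  shows "char (distr M borel (\<lambda>x. c * x)) t = char M (c * t)"
proof -
  interpret real_distribution M by fact
  show ?thesis unfolding char_def
    by (subst integral_distr) (auto simp: mult_ac)
qed

text \<open>
  Independence means that the joint law of the coordinates is the product of their laws; the joint
  law is the product measure itself, and its marginals are the factors.
\<close>
lemma indep_vars_PiM_components:
  assumes "I \<noteq> {}" and N: "\<And>i. i \<in> I \<Longrightarrow> prob_space (N i)"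
    and sets: "\<And>i. i \<in> I \<Longrightarrow> sets (N i) = sets (K i)"
  shows "prob_space.indep_vars (PiM I N) K (\<lambda>i \<omega>. \<omega> i) I"
proof -
  interpret prob_space "PiM I N" by (intro prob_space_PiM N)
  have comp: "(\<lambda>\<omega>. \<omega> i) \<in> PiM I N \<rightarrow>\<^sub>M K i" if "i \<in> I" for i
    using measurable_component_singleton[OF that, of N]
    by (simp cong: measurable_cong_sets add: measurable_cong_sets[OF refl sets[OF that]])
  have setsP: "sets (PiM I K) = sets (PiM I N)"
    by (intro sets_PiM_cong) (simp_all add: sets)
  have "distr (PiM I N) (PiM I K) (\<lambda>x. \<lambda>i\<in>I. x i) = distr (PiM I N) (PiM I N) (\<lambda>x. x)"
    by (intro distr_cong setsP) (auto simp: space_PiM PiE_def extensional_restrict)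
  also have "\<dots> = PiM I (\<lambda>i. distr (PiM I N) (K i) (\<lambda>\<omega>. \<omega> i))"
  proof -
    have "distr (PiM I N) (K i) (\<lambda>\<omega>. \<omega> i) = N i" if "i \<in> I" for i
      using distr_PiM_component[of I N i, OF N that] sets[OF that]
      by (metis distr_cong)
    then show ?thesis by (simp cong: PiM_cong)
  qed
  finally show ?thesis
    using assms(1) comp by (subst indep_vars_iff_distr_eq_PiM') auto
qed

text \<open>
  The witness is the law of the sum of the coordinates under the product of the rescaled measures,
  i.e. the law of \<open>\<Sum>i\<in>I. a i * X i\<close> for independent \<open>X i\<close> with law \<open>M\<close>.
\<close>
lemma weighted_sum_distribution:
  fixes a :: "'i \<Rightarrow> real"
  assumes M: "real_distribution M" "AE x in M. \<bar>x\<bar> \<le> 1"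
    and I: "finite I" "I \<noteq> {}" and a: "\<And>i. i \<in> I \<Longrightarrow> 0 \<le> a i"
  obtains S where "real_distribution S" "\<And>t. char S t = (\<Prod>i\<in>I. char M (a i * t))"
    "AE x in S. \<bar>x\<bar> \<le> (\<Sum>i\<in>I. a i)"
proof -
  interpret M: real_distribution M by fact
  define N where "N i = distr M borel (\<lambda>x. a i * x)" for i
  have N: "prob_space (N i)" and setsN [measurable_cong]: "sets (N i) = sets borel" for i
    unfolding N_def by (auto intro!: M.prob_space_distr)
  interpret P: prob_space "PiM I N" by (intro prob_space_PiM N)
  have indep: "P.indep_vars (\<lambda>_. borel) (\<lambda>i \<omega>. \<omega> i) I"
    by (intro indep_vars_PiM_components I N setsN)
  have meas [measurable]: "(\<lambda>\<omega>. \<Sum>i\<in>I. \<omega> i) \<in> borel_measurable (PiM I N)"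
    using indep unfolding P.indep_vars_def by (intro borel_measurable_sum) auto
  define S where "S = distr (PiM I N) borel (\<lambda>\<omega>. \<Sum>i\<in>I. \<omega> i)"
  have "real_distribution S"
    unfolding S_def by (rule P.real_distribution_distr[OF meas])
  moreover have "char S t = (\<Prod>i\<in>I. char M (a i * t))" for t
  proof -
    have "distr (PiM I N) borel (\<lambda>\<omega>. \<omega> i) = N i" if "i \<in> I" for i
      using distr_PiM_component[of I N i, OF N that] setsN[of i] by (metis distr_cong)
    then show ?thesis
      unfolding S_def P.char_distr_sum[OF indep]
      by (intro prod.cong refl) (simp add: N_def char_distr_scale[OF M(1)])
  qed
  moreover have "AE x in S. \<bar>x\<bar> \<le> (\<Sum>i\<in>I. a i)"
  proof -
    have "AE x in N i. \<bar>x\<bar> \<le> a i" if "i \<in> I" for i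
    proof -
      have "AE x in M. \<bar>a i * x\<bar> \<le> a i"
        using M(2)
      proof eventually_elim
        case (elim x)
        with a[OF that] show ?case
          using mult_left_mono[of "\<bar>x\<bar>" 1 "a i"] by (simp add: abs_mult)
      qed
      then show ?thesis unfolding N_def by (subst AE_distr_iff) auto
    qed
    then have "AE \<omega> in PiM I N. \<forall>i\<in>I. \<bar>\<omega> i\<bar> \<le> a i"
      using I(1) by (intro eventually_ball_finite ballI AE_PiM_component N) auto
    then have "AE \<omega> in PiM I N. \<bar>\<Sum>i\<in>I. \<omega> i\<bar> \<le> (\<Sum>i\<in>I. a i)"
      by eventually_elim (rule order_trans[OF sum_abs], rule sum_mono, auto)
    then show ?thesis unfolding S_def by (subst AE_distr_iff) auto
  qed
  ultimately show ?thesis using that by blast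
qed

section \<open>The Dirichlet kernel against a characteristic function\<close>

text \<open>
  Levy inversion on \<open>(-b, b]\<close>: the measure has no mass at \<open>\<plusminus>b\<close>, and the interval carries all
  of it. Integrability of \<open>g\<close> turns the limit of the integrals over \<open>(-T, T)\<close> into the integral over
  the real line. The value of \<open>g\<close> at \<open>0\<close> is left open, so that any continuation of
  \<open>sin (b * t) / t\<close> to \<open>0\<close> can be used.
\<close>
lemma integral_char_sin_over_t:
  fixes g :: "real \<Rightarrow> real"
  assumes M: "real_distribution M" and bounded: "AE x in M. \<bar>x\<bar> \<le> s" and "s < b" "0 < b"
    and g: "integrable lborel g"
    and g_eq: "\<And>t. t \<noteq> 0 \<Longrightarrow> complex_of_real (g t) = char M t * (sin (b * t) / t)"
  shows "(LINT t|lborel. g t) = pi"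
proof -
  interpret real_distribution M by fact
  have null: "measure M {x} = 0" if "\<bar>x\<bar> = b" for x
  proof -
    have "AE y in M. y \<notin> {x}"
      using bounded by eventually_elim (use that \<open>s < b\<close> in auto)
    then show ?thesis by (simp add: prob_eq_0)
  qed
  have full: "measure M {-b<..b} = 1"
  proof -
    have "AE y in M. y \<in> {-b<..b}"
      using bounded by eventually_elim (use \<open>s < b\<close> in auto)
    then show ?thesis by (simp add: prob_eq_1)
  qed
  have kernel: "(iexp (-(t * (-b))) - iexp (-(t * b))) / (\<i> * t) * char M t = 2 * complex_of_real (g t)"
    if "t \<noteq> 0" for t
    using that g_eq[OF that]
    by (simp add: complex_eq_iff Re_exp Im_exp Re_divide Im_divide field_simps power2_eq_square
        flip: cis_conv_exp)
  have lim: "(\<lambda>T. 1 / (2 * pi) * (CLBINT t=-real T..real T.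
      (iexp (-(t * (-b))) - iexp (-(t * b))) / (\<i> * t) * char M t)) \<longlonglongrightarrow> measure M {-b<..b}"
    using Levy_Inversion[of "-b" b] \<open>0 < b\<close> null
    unfolding of_int_minus of_int_of_nat_eq by auto
  have int_eq: "(CLBINT t=-real T..real T.
      (iexp (-(t * (-b))) - iexp (-(t * b))) / (\<i> * t) * char M t) =
      complex_of_real (2 * (LINT t|lborel. indicator {-real T<..<real T} t *\<^sub>R g t))" for T
  proof -
    have "(CLBINT t=-real T..real T.
        (iexp (-(t * (-b))) - iexp (-(t * b))) / (\<i> * t) * char M t) =
      (CLINT t|lborel. complex_of_real (2 * (indicator {-real T<..<real T} t *\<^sub>R g t)))"
      unfolding interval_lebesgue_integral_def set_lebesgue_integral_def einterval_eq
    proof (subst if_P, simp, rule integral_cong_AE)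
      \<comment> \<open>At \<open>t = 0\<close> the kernel has the value \<open>0\<close> of a division by zero, while \<open>g 0\<close> is arbitrary.\<close>
      show "AE t in lborel. indicator {-real T<..<real T} t *\<^sub>R
          ((iexp (-(t * (-b))) - iexp (-(t * b))) / (\<i> * t) * char M t) =
        complex_of_real (2 * (indicator {-real T<..<real T} t *\<^sub>R g t))"
        using AE_lborel_singleton[of "0::real"]
      proof eventually_elim
        case (elim t)
        then have "t \<noteq> 0" by simp
        show ?case
          unfolding kernel[OF \<open>t \<noteq> 0\<close>] by (simp add: scaleR_conv_of_real)
      qed
    qed (use g in auto)
    then show ?thesis by (simp add: integral_complex_of_real del: of_real_mult)
  qed
  have lim': "(\<lambda>T. LINT t|lborel. indicator {-real T<..<real T} t *\<^sub>R g t) \<longlonglongrightarrow> (LINT t|lborel. g t)"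
  proof (rule integral_dominated_convergence[where w = "\<lambda>t. \<bar>g t\<bar>"])
    show "AE t in lborel. (\<lambda>T. indicator {-real T<..<real T} t *\<^sub>R g t) \<longlonglongrightarrow> g t"
    proof (rule AE_I2)
      fix t :: real
      obtain k :: nat where "\<bar>t\<bar> < real k" using reals_Archimedean2 by blast
      then have "\<forall>\<^sub>F T in sequentially. g t = indicator {-real T<..<real T} t *\<^sub>R g t"
        by (auto simp: eventually_sequentially split: split_indicator intro!: exI[of _ k])
      then show "(\<lambda>T. indicator {-real T<..<real T} t *\<^sub>R g t) \<longlonglongrightarrow> g t"
        by (rule Lim_transform_eventually[OF tendsto_const])
    qed
  qed (use g in \<open>auto split: split_indicator\<close>)
  have "(\<lambda>T. 1 / pi * (LINT t|lborel. indicator {-real T<..<real T} t *\<^sub>R g t)) \<longlonglongrightarrow> 1"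
  proof -
    have "(\<lambda>T. complex_of_real (1 / pi * (LINT t|lborel. indicator {-real T<..<real T} t *\<^sub>R g t)))
        \<longlonglongrightarrow> complex_of_real 1"
      using lim unfolding int_eq full by simp
    then show ?thesis by (simp only: tendsto_of_real_iff)
  qed
  moreover have "(\<lambda>T. 1 / pi * (LINT t|lborel. indicator {-real T<..<real T} t *\<^sub>R g t)) \<longlonglongrightarrow>
      1 / pi * (LINT t|lborel. g t)"
    by (intro tendsto_intros lim')
  ultimately have "1 / pi * (LINT t|lborel. g t) = 1"
    by (rule LIMSEQ_unique[rotated])
  then show ?thesis by (simp add: field_simps)
qed

section \<open>Integrability and the evaluation\<close>

text \<open>
  The numerator of \<open>f\<close> grows at most linearly and the denominator quadratically. The resulting decay
  \<open>f t = O(1 / t)\<close> is the one expected from a density with jumps, here at \<open>\<plusminus>1\<close>.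
\<close>
lemma abs_mult_f_le: "\<bar>t\<bar> * \<bar>f t\<bar> \<le> (2 + exp 1) / (exp 1 - 1)"
proof -
  have E: "exp 1 - 1 > (0::real)" by simp
  have tpos: "1 + t\<^sup>2 > 0" by (metis add_pos_nonneg zero_le_power2 zero_less_one)
  have "\<bar>t * sin t - cos t + exp 1\<bar> \<le> \<bar>t\<bar> + (1 + exp 1)"
  proof -
    have "\<bar>t * sin t\<bar> \<le> \<bar>t\<bar>"
      by (simp add: abs_mult mult_left_le)
    moreover have "\<bar>cos t\<bar> \<le> 1" by simp
    ultimately show ?thesis using exp_gt_zero[of "1::real"] by linarith
  qed
  then have "\<bar>t\<bar> * \<bar>t * sin t - cos t + exp 1\<bar> \<le> \<bar>t\<bar> * (\<bar>t\<bar> + (1 + exp 1))"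
    by (intro mult_left_mono) auto
  also have "\<dots> = t\<^sup>2 + \<bar>t\<bar> * (1 + exp 1)"
    by (simp add: algebra_simps power2_eq_square)
  also have "\<dots> \<le> (1 + t\<^sup>2) + (1 + t\<^sup>2) * (1 + exp 1)"
  proof -
    have "\<bar>t\<bar> \<le> 1 + t\<^sup>2"
      using zero_le_power2[of "\<bar>t\<bar> - 1"] by (simp add: power2_diff)
    then show ?thesis by (intro add_mono mult_right_mono) auto
  qed
  finally have "\<bar>t\<bar> * \<bar>t * sin t - cos t + exp 1\<bar> \<le> (1 + t\<^sup>2) * (2 + exp 1)"
    by (simp add: algebra_simps)
  with E tpos show ?thesis
    unfolding f_def by (simp add: abs_mult divide_simps) (simp add: algebra_simps)
qed

lemma integrable_inverse_1_plus_square_lborel: "integrable lborel (\<lambda>x::real. inverse (1 + x\<^sup>2))"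
  using integrable_inverse_1_plus_square by (simp add: set_integrable_def)

text \<open>
  The integrand is bounded by \<open>b\<close>, since \<open>\<bar>f\<bar> \<le> 1\<close> and \<open>\<bar>sin u\<bar> \<le> \<bar>u\<bar>\<close>, and by \<open>K / t\<^sup>2\<close>
  for a constant \<open>K\<close>, by the decay of the factor with index \<open>0\<close>. Adding the first bound to \<open>t\<^sup>2\<close> times the second gives one majorant
  \<open>(b + K) / (1 + t\<^sup>2)\<close> for the whole line.
\<close>
lemma integrable_integrand:
  assumes a: "\<And>i. i \<le> n \<Longrightarrow> a i > 0" and "b > 0"
  shows "integrable lborel (integrand n a b)"
proof -
  define K where "K = (2 + exp 1) / (exp 1 - 1) / a 0"
  have "a 0 > 0" using a by simp
  have fm [measurable]: "f \<in> borel_measurable borel" unfolding f_def by measurable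
  have meas: "integrand n a b \<in> borel_measurable borel" unfolding integrand_def by measurable
  have bound: "\<bar>integrand n a b t\<bar> \<le> (b + K) * inverse (1 + t\<^sup>2)" for t
  proof (cases "t = 0")
    case True
    have "K \<ge> 0" using \<open>a 0 > 0\<close> by (simp add: K_def)
    with True \<open>b > 0\<close> show ?thesis by (simp add: integrand_def)
  next
    case False
    have tail: "\<bar>\<Prod>i=1..n. f (a i * t)\<bar> \<le> 1"
      unfolding abs_prod by (intro prod_le_1) (auto simp: abs_f_le_1)
    have "\<bar>integrand n a b t\<bar> =
        \<bar>f (a 0 * t)\<bar> * \<bar>\<Prod>i=1..n. f (a i * t)\<bar> * \<bar>sin (b * t) / t\<bar>"
      using False by (simp add: integrand_def abs_mult prod.atLeast_Suc_atMost)
    also have "\<dots> \<le> \<bar>f (a 0 * t)\<bar> * 1 * \<bar>sin (b * t) / t\<bar>"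
      by (intro mult_right_mono mult_left_mono tail) auto
    finally have le: "\<bar>integrand n a b t\<bar> \<le> \<bar>f (a 0 * t)\<bar> * \<bar>sin (b * t) / t\<bar>" by simp
    have "\<bar>sin (b * t)\<bar> \<le> b * \<bar>t\<bar>"
      using abs_sin_x_le_abs_x[of "b * t"] \<open>b > 0\<close> by (simp add: abs_mult)
    then have "\<bar>sin (b * t) / t\<bar> \<le> b"
      using False by (simp add: field_simps)
    then have "\<bar>f (a 0 * t)\<bar> * \<bar>sin (b * t) / t\<bar> \<le> 1 * b"
      using \<open>b > 0\<close> by (intro mult_mono abs_f_le_1) auto
    with le have near: "\<bar>integrand n a b t\<bar> \<le> b" by simp
    have "t\<^sup>2 * \<bar>integrand n a b t\<bar> \<le> t\<^sup>2 * (\<bar>f (a 0 * t)\<bar> * \<bar>sin (b * t) / t\<bar>)"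
      by (intro mult_left_mono le) auto
    also have "\<dots> = (\<bar>t\<bar> * \<bar>f (a 0 * t)\<bar>) * \<bar>sin (b * t)\<bar>"
      using False by (simp add: field_simps power2_eq_square)
    also have "\<dots> \<le> (\<bar>t\<bar> * \<bar>f (a 0 * t)\<bar>) * 1"
      by (intro mult_left_mono) auto
    also have "\<bar>t\<bar> * \<bar>f (a 0 * t)\<bar> \<le> K"
      using abs_mult_f_le[of "a 0 * t"] \<open>a 0 > 0\<close>
      by (simp add: K_def abs_mult pos_le_divide_eq mult_ac)
    finally have "t\<^sup>2 * \<bar>integrand n a b t\<bar> \<le> K" by simp
    with near have "\<bar>integrand n a b t\<bar> * (1 + t\<^sup>2) \<le> b + K"
      by (simp add: algebra_simps)
    moreover have "1 + t\<^sup>2 > 0" by (metis add_pos_nonneg zero_le_power2 zero_less_one)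
    ultimately show ?thesis by (simp add: field_simps)
  qed
  have "integrable lborel (\<lambda>t. (b + K) * inverse (1 + t\<^sup>2))"
    by (intro integrable_mult_right integrable_inverse_1_plus_square_lborel)
  then show ?thesis
    by (rule Bochner_Integration.integrable_bound)
      (use meas bound in \<open>auto intro: order_trans[OF _ abs_ge_self]\<close>)
qed

theorem mainTheorem4:
  fixes n :: nat and a :: "nat \<Rightarrow> real" and b :: real
  assumes "\<And>i. i \<le> n \<Longrightarrow> a i > 0"
    and "b > 0"
    and "(\<Sum>i=0..n. a i) < b"
  shows "integrable lborel (integrand n a b) \<and>
         (LINT t|lborel. integrand n a b t) = pi"
proof
  show int: "integrable lborel (integrand n a b)"
    by (rule integrable_integrand[OF assms(1,2)])
  obtain S where S: "real_distribution S"
    and char_S: "\<And>t. char S t = (\<Prod>i=0..n. char truncated_laplace (a i * t))"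
    and supp: "AE x in S. \<bar>x\<bar> \<le> (\<Sum>i=0..n. a i)"
    using weighted_sum_distribution[OF real_distribution_truncated_laplace
        AE_truncated_laplace_bounded, of "{0..n}" a] assms(1)
    by (metis atLeastAtMost_iff atLeastatMost_empty_iff2 finite_atLeastAtMost less_imp_le zero_le)
  show "(LINT t|lborel. integrand n a b t) = pi"
  proof (rule integral_char_sin_over_t[OF S supp assms(3,2) int])
    fix t :: real
    assume "t \<noteq> 0"
    then show "complex_of_real (integrand n a b t) = char S t * (sin (b * t) / t)"
      by (simp add: integrand_def char_S char_truncated_laplace)
  qed
qed

end
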